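(* Let $n\ge2$ be an integer. For $r_0<0$ let $\varphi_{r_0}=\arctan g_{r_0}'$ denote the angle function of the solution $g_{r_0}$ of $$\frac{g''}{1+(g')^2}=\Big(\frac r2-\frac{n-1}{r}\Big)g'-\frac g2$$ satisfying $g(r_0)=0$ and $g'(r_0)=+\infty$, and let $\varphi_{-\sqrt{2n}}$ denote the angle function of the spherical solution $g(r)=\sqrt{2n-r^2}$. Then: - when $r_0>-\sqrt{2n}$ is sufficiently close to $-\sqrt{2n}$, one has $\varphi_{r_0}>\varphi_{-\sqrt{2n}}$; - when $r_0<-\sqrt{2n}$ is sufficiently close to $-\sqrt{2n}$, one has $\varphi_{r_0}<\varphi_{-\sqrt{2n}}$, the inequalities being understood pointwise in $r$ where the portions of the two solutions under consideration are both defined.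
   Context: The equation is that of profile curves $x=g(r)$ of rotationally symmetric self-shrinkers in $\mathbb R^{n+1}$ (rotation about the $x$-axis), considered here for $r<0$ by formal extension (it is invariant under $r\mapsto-r$). The initial condition $g'(r_0)=+\infty$ means that $g$ is defined to the right of $r_0$, is continuous at $r_0$, and $g'(r)\to+\infty$ as $r\to r_0^+$, i.e. $\varphi(r_0)=\pi/2$. Convention: for a solution $g$ starting at $r_0$, only the portion to the right of $r_0$ (inside $r<0$) on which $g\ge0$ and $g'\ge0$ is considered; for the spherical solution this portion is $-\sqrt{2n}<r<0$. *)

theory Defs
  imports "HOL-Analysis.Analysis"
begin

definition shrinker_ode :: "nat \<Rightarrow> (real \<Rightarrow> real) \<Rightarrow> real \<Rightarrow> bool" where
  "shrinker_ode n g r \<longleftrightarrow>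
     g differentiable (at r) \<and> deriv g differentiable (at r) \<and>
     deriv (deriv g) r / (1 + (deriv g r)\<^sup>2)
       = (r / 2 - (real n - 1) / r) * deriv g r - g r / 2"

text \<open>
  \<open>g\<close> solves the equation on the open interval between \<open>r0\<close> and \<open>c\<close>, inside \<open>r < 0\<close>, with
  \<open>g(r0) = 0\<close> and vertical tangent \<open>g'(r0) = +\<infinity>\<close>. The right end \<open>c\<close> is arbitrary, so the
  maximal solution and all its restrictions are covered; the values of \<open>g\<close> outside
  the interval are irrelevant.
\<close>

definition shrinker_solution :: "nat \<Rightarrow> real \<Rightarrow> real \<Rightarrow> (real \<Rightarrow> real) \<Rightarrow> bool" where
  "shrinker_solution n r0 c g \<longleftrightarrow>
     r0 < c \<and> c \<le> 0 \<and>
     (\<forall>r\<in>{r0<..<c}. shrinker_ode n g r) \<and>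
     g r0 = 0 \<and> continuous (at_right r0) g \<and>
     filterlim (deriv g) at_top (at_right r0)"

text \<open>
  The portion considered is the interval starting at \<open>r0\<close> (exclusive) along which both
  \<open>g\<close> and \<open>g'\<close> have stayed nonnegative; a point where \<open>g'\<close> first vanishes is included.
\<close>

definition portion :: "real \<Rightarrow> real \<Rightarrow> (real \<Rightarrow> real) \<Rightarrow> real set" where
  "portion r0 c g = {r \<in> {r0<..<c}. \<forall>s\<in>{r0<..r}. 0 \<le> g s \<and> 0 \<le> deriv g s}"

definition angle :: "(real \<Rightarrow> real) \<Rightarrow> real \<Rightarrow> real" where
  "angle g r = arctan (deriv g r)"

definition sphere_profile :: "nat \<Rightarrow> real \<Rightarrow> real" where
  "sphere_profile n r = sqrt (2 * real n - r\<^sup>2)"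

lemma sphere_profile_radicand_pos:
  assumes "- sqrt (2 * real n) < r" "r < 0"
  shows "0 < 2 * real n - r\<^sup>2"
proof -
  have "(- r)\<^sup>2 < (sqrt (2 * real n))\<^sup>2"
    using assms by (intro power_strict_mono) auto
  then show ?thesis by simp
qed

lemma sphere_profile_has_derivative:
  assumes "- sqrt (2 * real n) < r" "r < 0"
  shows "(sphere_profile n has_real_derivative - r / sphere_profile n r) (at r)"
  using sphere_profile_radicand_pos[OF assms] unfolding sphere_profile_def
  by (auto intro!: derivative_eq_intros simp: field_simps)

lemma deriv_sphere_profile:
  assumes "- sqrt (2 * real n) < r" "r < 0"
  shows "deriv (sphere_profile n) r = - r / sphere_profile n r"
  using sphere_profile_has_derivative[OF assms] by (rule DERIV_imp_deriv)

lemma sphere_profile_has_second_derivative: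
  assumes "- sqrt (2 * real n) < r" "r < 0"
  shows "(deriv (sphere_profile n) has_real_derivative
           - (2 * real n) / (sphere_profile n r)^3) (at r)"
proof -
  let ?g = "sphere_profile n"
  have pos: "0 < 2 * real n - r\<^sup>2"
    by (rule sphere_profile_radicand_pos[OF assms])
  then have g: "0 < ?g r" and sq: "(?g r)\<^sup>2 = 2 * real n - r\<^sup>2"
    by (simp_all add: sphere_profile_def)
  have "((\<lambda>r. - r / ?g r) has_real_derivative
          ((- 1) * ?g r - (- r) * (- r / ?g r)) / (?g r * ?g r)) (at r)"
    using g by (intro DERIV_divide sphere_profile_has_derivative assms)
      (auto intro!: derivative_eq_intros)
  also have "((- 1) * ?g r - (- r) * (- r / ?g r)) / (?g r * ?g r)
      = - ((?g r)\<^sup>2 + r\<^sup>2) / (?g r)^3"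
    using g by (simp add: field_simps power2_eq_square power3_eq_cube)
  also have "\<dots> = - (2 * real n) / (?g r)^3"
    using sq by simp
  finally have *: "((\<lambda>r. - r / ?g r) has_real_derivative - (2 * real n) / (?g r)^3) (at r)" .
  show ?thesis
    by (rule has_field_derivative_transform_within_open[OF *,
          of "{- sqrt (2 * real n)<..<0}"])
      (use assms in \<open>auto simp: deriv_sphere_profile\<close>)
qed

lemma sphere_profile_shrinker_ode:
  assumes "- sqrt (2 * real n) < r" "r < 0"
  shows "shrinker_ode n (sphere_profile n) r"
proof -
  let ?g = "sphere_profile n"
  note d1 = sphere_profile_has_derivative[OF assms]
  note d2 = sphere_profile_has_second_derivative[OF assms]
  have pos: "0 < 2 * real n - r\<^sup>2"
    by (rule sphere_profile_radicand_pos[OF assms])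
  then have g: "0 < ?g r" and sq: "(?g r)\<^sup>2 = 2 * real n - r\<^sup>2"
    by (simp_all add: sphere_profile_def)
  have n: "2 * real n = (?g r)\<^sup>2 + r\<^sup>2" using sq by simp
  have n0: "(?g r)\<^sup>2 + r\<^sup>2 \<noteq> 0" using g by (metis sum_power2_eq_zero_iff less_irrefl)
  have q: "1 + (- r / ?g r)\<^sup>2 = ((?g r)\<^sup>2 + r\<^sup>2) / (?g r)\<^sup>2"
    using g by (simp add: field_simps power2_eq_square)
  have L: "- (2 * real n) / (?g r)^3 / (1 + (- r / ?g r)\<^sup>2) = - 1 / ?g r"
  proof -
    have aux: "- k / y^3 / (k / y\<^sup>2) = - 1 / y" if "k \<noteq> 0" "y \<noteq> 0" for k y :: real
      using that by (simp add: divide_simps power2_eq_square power3_eq_cube)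
    show ?thesis
      unfolding q n using aux[OF n0, of "?g r"] g by simp
  qed
  have rn: "real n = ((?g r)\<^sup>2 + r\<^sup>2) / 2" using n by simp
  have R: "(r / 2 - (real n - 1) / r) * (- r / ?g r) - ?g r / 2 = - 1 / ?g r"
    using g assms(2) unfolding rn by (simp add: field_simps power2_eq_square)
  show ?thesis
    unfolding shrinker_ode_def DERIV_imp_deriv[OF d2] DERIV_imp_deriv[OF d1] L R
    using d1 d2 by (auto simp: real_differentiable_def)
qed

lemma shrinker_solution_sphere_profile:
  assumes "n > 0"
  shows "shrinker_solution n (- sqrt (2 * real n)) 0 (sphere_profile n)"
proof -
  let ?R = "sqrt (2 * real n)" and ?g = "sphere_profile n"
  have R: "0 < ?R" using assms by simp
  have ev: "\<forall>\<^sub>F r in at_right (- ?R). r \<in> {- ?R<..<0}"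
    using R by (intro eventually_at_right_real) auto
  have cont: "continuous (at_right (- ?R)) ?g"
    unfolding sphere_profile_def by (intro continuous_intros)
  have g0: "?g (- ?R) = 0" by (simp add: sphere_profile_def)
  have lim: "filterlim (\<lambda>r. - r / ?g r) at_top (at_right (- ?R))"
  proof (rule LIM_at_top_divide)
    show "((\<lambda>r. - r) \<longlongrightarrow> ?R) (at_right (- ?R))"
      by (auto intro!: tendsto_eq_intros)
    show "(?g \<longlongrightarrow> 0) (at_right (- ?R))"
      using cont g0 by (simp add: continuous_within)
    show "\<forall>\<^sub>F r in at_right (- ?R). 0 < ?g r"
      using ev by eventually_elim
        (auto simp: sphere_profile_def dest: sphere_profile_radicand_pos)
  qed (fact R)
  have "filterlim (deriv ?g) at_top (at_right (- ?R))"
    by (rule filterlim_mono_eventually[OF lim order_refl order_refl])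
      (use ev in eventually_elim, simp add: deriv_sphere_profile)
  then show ?thesis
    using R cont g0 by (auto simp: shrinker_solution_def intro!: sphere_profile_shrinker_ode)
qed

lemma portion_sphere_profile:
  "portion (- sqrt (2 * real n)) 0 (sphere_profile n) = {- sqrt (2 * real n)<..<0}"
proof -
  have "0 \<le> sphere_profile n s \<and> 0 \<le> deriv (sphere_profile n) s"
    if "- sqrt (2 * real n) < s" "s < 0" for s
    using that sphere_profile_radicand_pos[OF that]
    by (simp add: deriv_sphere_profile) (simp add: sphere_profile_def divide_nonpos_nonneg)
  then show ?thesis by (auto simp: portion_def)
qed

end

theory Submission
  imports Defs
begin

text \<open>
  On the sphere \<open>sin \<phi> = - r / sqrt (2 n)\<close>, so the angles compare as the rotational principal
  curvature \<open>\<psi> = - sin \<phi> / r\<close> compares with \<open>1 / sqrt (2 n)\<close>. The curvature of the profile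
  curve is \<open>k = S - (n - 1) \<psi>\<close>, where \<open>S\<close> is half the support function, and
  \<open>\<psi>' = - D / r\<close> for \<open>D = n \<psi> - S = \<psi> - k\<close>. Near \<open>r0\<close> the sign of \<open>D\<close> is that of
  \<open>r0 + sqrt (2 n)\<close>; everything follows once \<open>D\<close> is shown to keep this sign.

  With \<open>T\<close> half the derivative of \<open>|X|\<^sup>2\<close> in arc length, \<open>D\<close> can only change sign if \<open>T / D\<close> blows up.
  At the sphere \<open>w = T / (2 D)\<close> solves the Riccati equation
  \<open>w' = n - (n + 1) w tan \<alpha> + w\<^sup>2\<close> in \<open>\<alpha> = \<pi> / 2 - \<phi>\<close>. The second spherical harmonic, with
  eigenvalue \<open>2 n + 2\<close> instead of \<open>2 n\<close>, gives the supersolution \<open>(n + 1) sin \<alpha> cos \<alpha>\<close>,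
  which is degenerate at \<open>sin\<^sup>2 \<alpha> = 1 / (n + 1)\<close>; adding \<open>sin\<^sup>3 \<alpha> cos \<alpha>\<close> makes it strict, hence
  stable as long as \<open>|D| / \<psi>\<close> is small. For \<open>D > 0\<close> the nonlinear terms help where
  \<open>sin\<^sup>2 \<alpha> \<ge> 1/2\<close>. For \<open>D < 0\<close>, the ratio \<open>|D| / \<psi>\<close> becomes large only very close to the axis
  \<open>r = 0\<close>, and from there on \<open>|D|\<close> dominates a multiple of \<open>r\<^sup>2\<close>, which prevents a zero.
\<close>

section \<open>One-sided calculus: monotonicity from a limit, first and last zeros\<close>

text \<open>Since \<open>g'\<close> blows up at \<open>r0\<close>, the quantities of the curve enter
  there only through right limits. The sign of the derivative is required only before
  \<open>b\<close>, so that \<open>b\<close> may be a hypothetical first zero.\<close>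

lemma left_limit_le_of_deriv_nonneg:
  fixes f f' :: "real \<Rightarrow> real"
  assumes "a < b" and lim: "(f \<longlongrightarrow> L) (at_right a)"
    and d: "\<And>r. a < r \<Longrightarrow> r \<le> b \<Longrightarrow> (f has_real_derivative f' r) (at r)"
    and nn: "\<And>r. a < r \<Longrightarrow> r < b \<Longrightarrow> 0 \<le> f' r"
  shows "L \<le> f b"
proof -
  have "f y \<le> f b" if "a < y" "y < b" for y
  proof (rule DERIV_nonneg_imp_increasing_open[of y b f])
    show "y \<le> b" using that by simp
    show "\<exists>z. (f has_real_derivative z) (at x) \<and> 0 \<le> z" if "y < x" "x < b" for x
      using d[of x] nn[of x] that \<open>a < y\<close> by (intro exI[of _ "f' x"]) auto
    show "continuous_on {y..b} f"
      using DERIV_isCont[OF d] \<open>a < y\<close> by (intro continuous_at_imp_continuous_on) auto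
  qed
  then have "\<forall>\<^sub>F y in at_right a. f y \<le> f b"
    using eventually_at_right_real[OF \<open>a < b\<close>] by (auto elim: eventually_mono)
  then show ?thesis
    using tendsto_upperbound[OF lim] by simp
qed

text \<open>Eventual positivity moves the left end to some \<open>a'\<close> inside the interval;
  the minimum of the compact set where \<open>f \<le> 0\<close> on \<open>[a', b]\<close> is the
  zero, a negative value there being incompatible with positivity just before it.\<close>

lemma ex_first_zero:
  fixes f :: "real \<Rightarrow> real"
  assumes cont: "\<And>r. a < r \<Longrightarrow> r \<le> b \<Longrightarrow> isCont f r"
    and pos: "\<forall>\<^sub>F r in at_right a. 0 < f r" and "a < b" "f b \<le> 0"
  shows "\<exists>r1. a < r1 \<and> r1 \<le> b \<and> f r1 = 0 \<and> (\<forall>r. a < r \<and> r < r1 \<longrightarrow> 0 < f r)"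
proof -
  obtain y where y: "a < y" "\<And>r. a < r \<Longrightarrow> r < y \<Longrightarrow> 0 < f r"
    using pos unfolding eventually_at_right_field by auto
  define a' where "a' = min ((a + y) / 2) b"
  have a': "a < a'" "a' \<le> b" "a' < y"
    using y(1) \<open>a < b\<close> by (auto simp: a'_def min_less_iff_disj)
  define K where "K = {r \<in> {a'..b}. f r \<le> 0}"
  have "continuous_on {a'..b} f"
    using a' cont by (intro continuous_at_imp_continuous_on) auto
  then have "closed K"
    unfolding K_def by (intro continuous_on_closed_Collect_le) auto
  moreover have "bounded K"
    unfolding K_def by (rule bounded_subset[OF bounded_closed_interval[of a' b]]) auto
  ultimately have "compact K" by (simp add: compact_eq_bounded_closed)
  moreover have "b \<in> K" using a' \<open>f b \<le> 0\<close> by (simp add: K_def)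
  ultimately obtain r1 where r1: "r1 \<in> K" "\<And>r. r \<in> K \<Longrightarrow> r1 \<le> r"
    using compact_attains_inf by (metis empty_iff)
  have before: "0 < f r" if "a < r" "r < r1" for r
    using r1(2)[of r] y(2)[of r] that a' r1(1) by (cases "r < a'") (fastforce simp: K_def)+
  have "a < r1" using r1 a' by (auto simp: K_def)
  moreover have "f r1 = 0"
  proof (rule ccontr)
    assume "f r1 \<noteq> 0"
    then have "f r1 < 0" using r1 by (simp add: K_def)
    moreover have "isCont f r1" using cont r1 \<open>a < r1\<close> by (auto simp: K_def)
    ultimately have "\<forall>\<^sub>F r in at r1. f r < 0"
      using order_tendstoD(2) by (auto simp: isCont_def)
    then have "\<forall>\<^sub>F r in at_left r1. f r < 0"
      by (simp add: eventually_at_split)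
    moreover have "\<forall>\<^sub>F r in at_left r1. 0 < f r"
      using eventually_at_left_real[OF \<open>a < r1\<close>] before by (auto elim: eventually_mono)
    ultimately have "\<forall>\<^sub>F r in at_left r1. False"
      by eventually_elim auto
    then show False by simp
  qed
  ultimately show ?thesis using before r1(1) by (auto simp: K_def)
qed

text \<open>This is \<open>ex_first_zero\<close> reflected by
  \<open>r \<mapsto> - r\<close>.\<close>

lemma ex_last_zero:
  fixes f :: "real \<Rightarrow> real"
  assumes cont: "\<And>r. a \<le> r \<Longrightarrow> r \<le> b \<Longrightarrow> isCont f r" and "a \<le> b" "f a \<le> 0" "0 < f b"
  shows "\<exists>r1. a \<le> r1 \<and> r1 < b \<and> f r1 = 0 \<and> (\<forall>r. r1 < r \<and> r \<le> b \<longrightarrow> 0 < f r)"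
proof -
  have "\<exists>r1. -b < r1 \<and> r1 \<le> -a \<and> f (- r1) = 0 \<and> (\<forall>r. -b < r \<and> r < r1 \<longrightarrow> 0 < f (- r))"
  proof (rule ex_first_zero)
    show "isCont (\<lambda>r. f (- r)) r" if "- b < r" "r \<le> - a" for r
      using cont[of "- r"] that by (intro isCont_o2[of r uminus f]) auto
    have "\<forall>\<^sub>F r in at b. 0 < f r"
      using cont[of b] assms(2,4) order_tendstoD(1) by (auto simp: isCont_def)
    then have "\<forall>\<^sub>F r in at_left b. 0 < f r"
      by (simp add: eventually_at_split)
    then show "\<forall>\<^sub>F r in at_right (- b). 0 < f (- r)"
      by (simp add: at_left_minus eventually_filtermap)
    show "- b < - a" using assms by (cases "a = b") auto
    show "f (- (- a)) \<le> 0" using assms by simp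
  qed
  then obtain r1 where "-b < r1" "r1 \<le> -a" "f (- r1) = 0"
      and *: "\<And>r. -b < r \<Longrightarrow> r < r1 \<Longrightarrow> 0 < f (- r)" by auto
  moreover have "0 < f r" if "- r1 < r" "r \<le> b" for r
    using *[of "- r"] that assms(4) by (cases "r = b") auto
  ultimately show ?thesis by (intro exI[of _ "- r1"]) auto
qed

section \<open>The barrier polynomials\<close>

text \<open>
  With \<open>u = sin\<^sup>2 \<alpha>\<close> and the supersolution \<open>W = sin \<alpha> cos \<alpha> (m + 1 + u)\<close>, the slope is
  \<open>dW/d\<alpha>\<close>, the excess is \<open>W' + (m + 1) W tan \<alpha> - W\<^sup>2 - m\<close>, and the feedback
  \<open>1 + W\<^sup>2 - W'\<close> is the coefficient of the terms quadratic in \<open>D\<close>.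
\<close>

definition barrier_slope :: "real \<Rightarrow> real \<Rightarrow> real" where
  "barrier_slope m u = (1 - 2 * u) * (m + 1 + u) + 2 * u * (1 - u)"

definition barrier_excess :: "real \<Rightarrow> real \<Rightarrow> real" where
  "barrier_excess m u =
     barrier_slope m u + (m + 1) * u * (m + 1 + u) - u * (1 - u) * (m + 1 + u)\<^sup>2 - m"

definition barrier_feedback :: "real \<Rightarrow> real \<Rightarrow> real" where
  "barrier_feedback m u = 1 + u * (1 - u) * (m + 1 + u)\<^sup>2 - barrier_slope m u"

text \<open>Completing the square in \<open>v = (m + 1) u\<close> leaves the remainder
  \<open>u (8 - 9 u)\<close>, negative only for \<open>u > 8/9\<close>. There it is at least
  \<open>-1\<close>, while \<open>v \<ge> 3 u\<close> makes the square exceed 1.\<close>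

lemma barrier_excess_pos:
  assumes "2 \<le> m" "0 \<le> u" "u \<le> 1"
  shows "0 < barrier_excess m u"
proof -
  define v where "v = (m + 1) * u"
  have v: "3 * u \<le> v" using assms by (auto simp: v_def intro!: mult_right_mono)
  have eq: "4 * barrier_excess m u = (2 * v - (2 + u - 2 * u\<^sup>2))\<^sup>2 + u * (8 - 9 * u)"
    unfolding barrier_excess_def barrier_slope_def v_def by algebra
  have "0 < (2 * v - (2 + u - 2 * u\<^sup>2))\<^sup>2 + u * (8 - 9 * u)"
  proof (cases "u < 8 / 9")
    case True
    then show ?thesis
      using assms by (cases "u = 0") (auto simp: v_def intro!: add_nonneg_pos mult_pos_pos)
  next
    case False
    then have "1 < 2 * v - (2 + u - 2 * u\<^sup>2)"
      using v zero_le_power2[of u] by linarith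
    then have "1 < (2 * v - (2 + u - 2 * u\<^sup>2))\<^sup>2" by (simp add: one_less_power)
    moreover have "0 \<le> (1 - u) * (1 + 9 * u)" using assms by simp
    then have "- 1 \<le> u * (8 - 9 * u)" by (simp add: algebra_simps)
    ultimately show ?thesis by simp
  qed
  then show ?thesis using eq by simp
qed

text \<open>For \<open>u \<ge> 1/2\<close> the first term of the slope is nonpositive, and its
  second term \<open>2 u (1 - u)\<close> is absorbed by \<open>W\<^sup>2\<close>.\<close>

lemma barrier_feedback_nonneg:
  assumes "2 \<le> m" "1 / 2 \<le> u" "u \<le> 1"
  shows "0 \<le> barrier_feedback m u"
proof -
  have "2 * (u * (1 - u)) \<le> (m + 1 + u)\<^sup>2 * (u * (1 - u))"
  proof (rule mult_right_mono)
    have "2\<^sup>2 \<le> (m + 1 + u)\<^sup>2" using assms by (intro power_mono) auto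
    then show "2 \<le> (m + 1 + u)\<^sup>2" by simp
  qed (use assms in auto)
  moreover have "0 \<le> (2 * u - 1) * (m + 1 + u)" using assms by auto
  ultimately show ?thesis
    unfolding barrier_feedback_def barrier_slope_def by (simp add: algebra_simps)
qed

text \<open>By compactness of \<open>[0, 1]\<close>. As long as
  \<open>\<bar>D\<bar> \<le> \<eta> \<psi>\<close>, the feedback cannot outweigh the excess.\<close>

lemma barrier_threshold_exists:
  assumes "2 \<le> m"
  shows "\<exists>\<eta>>0. \<eta> \<le> 1 \<and>
    (\<forall>u. 0 \<le> u \<and> u \<le> 1 \<longrightarrow> \<eta> * \<bar>barrier_feedback m u\<bar> \<le> barrier_excess m u)"
proof -
  have "continuous_on {0..1} (barrier_excess m)"
    unfolding barrier_excess_def barrier_slope_def by (intro continuous_intros)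
  then obtain u0 where u0: "u0 \<in> {0..1}" "\<And>u. u \<in> {0..1} \<Longrightarrow> barrier_excess m u0 \<le> barrier_excess m u"
    using continuous_attains_inf[of "{0..1::real}" "barrier_excess m"] by auto
  have "continuous_on {0..1} (\<lambda>u. \<bar>barrier_feedback m u\<bar>)"
    unfolding barrier_feedback_def barrier_slope_def by (intro continuous_intros)
  then obtain u1 where u1: "\<And>u. u \<in> {0..1} \<Longrightarrow> \<bar>barrier_feedback m u\<bar> \<le> \<bar>barrier_feedback m u1\<bar>"
    using continuous_attains_sup[of "{0..1::real}" "\<lambda>u. \<bar>barrier_feedback m u\<bar>"]
    by (metis atLeastAtMost_iff compact_Icc empty_iff order_refl zero_le_one)
  define a where "a = barrier_excess m u0"
  define b where "b = 1 + \<bar>barrier_feedback m u1\<bar>"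
  have "0 < a" "0 < b" using barrier_excess_pos assms u0 by (auto simp: a_def b_def)
  have "min 1 (a / b) * \<bar>barrier_feedback m u\<bar> \<le> barrier_excess m u" if "0 \<le> u" "u \<le> 1" for u
  proof -
    have "min 1 (a / b) * \<bar>barrier_feedback m u\<bar> \<le> a / b * b"
      using u1[of u] that \<open>0 < a\<close> \<open>0 < b\<close> by (intro mult_mono) (auto simp: b_def)
    also have "\<dots> = a" using \<open>0 < b\<close> by simp
    finally show ?thesis using u0(2)[of u] that by (simp add: a_def)
  qed
  then show ?thesis using \<open>0 < a\<close> \<open>0 < b\<close> by (intro exI[of _ "min 1 (a / b)"]) auto
qed

section \<open>The profile curve and its differential system\<close>

lemma power_minus_deriv:
  fixes r :: real
  assumes "r < 0"
  shows "((\<lambda>r. (- r) ^ m) has_real_derivative real m * (- r) ^ m / r) (at r)"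
proof (cases m)
  case (Suc j)
  have "((\<lambda>r. (- r) ^ m) has_real_derivative real m * (- r) ^ j * (- 1)) (at r)"
    unfolding Suc by (rule derivative_eq_intros refl)+ simp
  also have "real m * (- r) ^ j * (- 1) = real m * (- r) ^ m / r"
    using assms Suc by simp
  finally show ?thesis .
qed auto

locale shrinker_arc =
  fixes n :: nat and r0 c :: real and g :: "real \<Rightarrow> real" and x :: real
  assumes n_ge_2: "2 \<le> n"
    and solution: "shrinker_solution n r0 c g"
    and x_in_portion: "x \<in> portion r0 c g"
begin

text \<open>In terms of \<open>\<alpha> = \<pi> / 2 - \<phi>\<close>, \<open>co\<close> is
  \<open>sin \<alpha>\<close> and \<open>si\<close> is \<open>cos \<alpha>\<close>; the barrier
  polynomials are therefore evaluated at \<open>u = (co r)\<^sup>2\<close>.\<close>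

definition "co r = cos (angle g r)"
definition "si r = sin (angle g r)"
definition "\<psi> r = - si r / r"
definition "S r = (g r * co r - r * si r) / 2"
definition "T r = g r * si r + r * co r"
definition "k r = S r - (real n - 1) * \<psi> r"
definition "D r = real n * \<psi> r - S r"

lemma r0_less_x: "r0 < x" and x_neg: "x < 0"
  using x_in_portion solution by (auto simp: portion_def shrinker_solution_def)

lemma arc_facts:
  assumes "r0 < r" "r \<le> x"
  shows "r < 0" "0 \<le> g r" "0 \<le> deriv g r" "shrinker_ode n g r"
  using assms x_in_portion solution by (auto simp: portion_def shrinker_solution_def)

lemma co_pos: "0 < co r"
  unfolding co_def angle_def by (rule cos_gt_zero_pi) (use arctan_bounded in auto)

lemma si_eq: "si r = deriv g r * co r"
  using co_pos[of r] tan_arctan[of "deriv g r"]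
  by (simp add: tan_def co_def si_def angle_def field_simps)

lemma si2: "(si r)\<^sup>2 = 1 - (co r)\<^sup>2"
  by (simp add: si_def co_def sin_squared_eq)

lemma co2_le_1: "(co r)\<^sup>2 \<le> 1"
  using si2[of r] zero_le_power2[of "si r"] by linarith

lemma si_nonneg: "r0 < r \<Longrightarrow> r \<le> x \<Longrightarrow> 0 \<le> si r"
  using arc_facts[of r] co_pos[of r] by (simp add: si_eq)

lemma psi_nonneg: "r0 < r \<Longrightarrow> r \<le> x \<Longrightarrow> 0 \<le> \<psi> r"
  using arc_facts[of r] si_nonneg[of r] by (simp add: \<psi>_def divide_nonneg_neg)

lemma S_nonneg:
  assumes "r0 < r" "r \<le> x"
  shows "0 \<le> S r"
proof -
  have "0 \<le> g r * co r" "r * si r \<le> 0"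
    using arc_facts[OF assms] si_nonneg[OF assms] co_pos[of r]
    by (auto intro: mult_nonpos_nonneg)
  then have "r * si r \<le> g r * co r" by linarith
  then show ?thesis by (simp add: S_def)
qed

lemma k_eq: "k r = \<psi> r - D r"
  by (simp add: k_def D_def algebra_simps)

lemma S_eq: "S r = real n * \<psi> r - D r"
  by (simp add: D_def)

text \<open>The pair \<open>(2 S, T)\<close> is the position \<open>(g, r)\<close> rotated by the
  angle; rotating back and dividing the second coordinate by \<open>r\<close> gives the
  identity.\<close>

lemma T_identity:
  assumes "r0 < r" "r \<le> x"
  shows "2 * S r * \<psi> r + T r * co r / r = 1"
proof -
  have "2 * S r * (- si r) + T r * co r = r * ((si r)\<^sup>2 + (co r)\<^sup>2)"
    unfolding S_def T_def by algebra
  then show ?thesis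
    using arc_facts[OF assms] by (simp add: si2 \<psi>_def field_simps)
qed

lemma g_deriv:
  assumes "r0 < r" "r \<le> x"
  shows "(g has_real_derivative si r / co r) (at r)"
  using arc_facts[OF assms] co_pos[of r]
  by (simp add: shrinker_ode_def si_eq DERIV_deriv_iff_real_differentiable)

text \<open>The left side of the equation is \<open>\<phi>'\<close>, and multiplying the right side
  by \<open>- cos \<phi>\<close> gives the curvature \<open>k\<close>.\<close>

lemma angle_deriv:
  assumes "r0 < r" "r \<le> x"
  shows "(angle g has_real_derivative - k r / co r) (at r)"
proof -
  note a = arc_facts[OF assms]
  have "(deriv g has_real_derivative deriv (deriv g) r) (at r)"
    using a by (simp add: shrinker_ode_def DERIV_deriv_iff_real_differentiable)
  then have "((\<lambda>r. arctan (deriv g r)) has_real_derivative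
      deriv (deriv g) r / (1 + (deriv g r)\<^sup>2)) (at r)"
    by (auto intro!: derivative_eq_intros simp: field_simps)
  also have "deriv (deriv g) r / (1 + (deriv g r)\<^sup>2) = - k r / co r"
    using a co_pos[of r]
    unfolding shrinker_ode_def
    by (elim conjE, simp only:) (simp add: k_def S_def \<psi>_def si_eq field_simps)
  finally show ?thesis unfolding angle_def[abs_def] .
qed

lemma co_deriv:
  assumes "r0 < r" "r \<le> x"
  shows "(co has_real_derivative si r * k r / co r) (at r)"
  unfolding co_def[abs_def] using co_pos[of r]
  by (auto intro!: derivative_eq_intros angle_deriv[OF assms] simp: si_def co_def)

lemma si_deriv:
  assumes "r0 < r" "r \<le> x"
  shows "(si has_real_derivative - k r) (at r)"
  unfolding si_def[abs_def] using co_pos[of r]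
  by (auto intro!: derivative_eq_intros angle_deriv[OF assms] simp: co_def)

lemma psi_deriv:
  assumes "r0 < r" "r \<le> x"
  shows "(\<psi> has_real_derivative - D r / r) (at r)"
  unfolding \<psi>_def[abs_def] using arc_facts[OF assms]
  by (auto intro!: derivative_eq_intros si_deriv[OF assms]
      simp: k_def D_def \<psi>_def field_simps power2_eq_square)

lemma S_deriv:
  assumes "r0 < r" "r \<le> x"
  shows "(S has_real_derivative k r * T r / (2 * co r)) (at r)"
  unfolding S_def[abs_def] using co_pos[of r]
  by (auto intro!: derivative_eq_intros g_deriv[OF assms] co_deriv[OF assms] si_deriv[OF assms]
      simp: T_def field_simps power2_eq_square)

text \<open>The constant term \<open>si\<^sup>2 + co\<^sup>2 = 1\<close> is replaced through
  \<open>T_identity\<close>, so that \<open>T\<close> is driven by \<open>D\<close> alone up to the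
  factor \<open>r\<close>.\<close>

lemma T_deriv:
  assumes "r0 < r" "r \<le> x"
  shows "(T has_real_derivative 2 * S r * D r / co r + T r / r) (at r)"
proof -
  have "(T has_real_derivative ((si r)\<^sup>2 + (co r)\<^sup>2 - 2 * k r * S r) / co r) (at r)"
    unfolding T_def[abs_def] using co_pos[of r]
    by (auto intro!: derivative_eq_intros g_deriv[OF assms] co_deriv[OF assms] si_deriv[OF assms]
        simp: S_def field_simps power2_eq_square)
  also have "(si r)\<^sup>2 + (co r)\<^sup>2 - 2 * k r * S r = 2 * S r * D r + T r * co r / r"
    using T_identity[OF assms] by (simp add: si2 k_eq algebra_simps)
  also have "\<dots> / co r = 2 * S r * D r / co r + T r / r"
    using co_pos[of r] by (simp add: add_divide_distrib)
  finally show ?thesis .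
qed

lemma D_deriv:
  assumes "r0 < r" "r \<le> x"
  shows "(D has_real_derivative - real n * D r / r - k r * T r / (2 * co r)) (at r)"
  unfolding D_def[abs_def]
  by (auto intro!: derivative_eq_intros psi_deriv[OF assms] S_deriv[OF assms] simp: D_def field_simps)

lemma k_deriv:
  assumes "r0 < r" "r \<le> x"
  shows "(k has_real_derivative (real n - 1) * D r / r + k r * T r / (2 * co r)) (at r)"
  unfolding k_def[abs_def]
  by (auto intro!: derivative_eq_intros psi_deriv[OF assms] S_deriv[OF assms] simp: k_def)

section \<open>The Riccati barrier along the curve\<close>

text \<open>
  \<open>F\<close> is the primitive of \<open>W\<close> in \<open>\<alpha>\<close>; it provides the integrating factors
  \<open>exp (- F r) / (- r)\<close> for \<open>Z\<close> and \<open>(- r) ^ n * exp (F r)\<close> for \<open>D\<close>.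
\<close>

definition "W r = co r * si r * (real n + 1 + (co r)\<^sup>2)"
definition "Z r = 2 * W r * D r - T r"
definition "F r = (real n + 1) * (co r)\<^sup>2 / 2 + (co r)^4 / 4"

lemma W_deriv:
  assumes "r0 < r" "r \<le> x"
  shows "(W has_real_derivative k r / co r * barrier_slope (real n) ((co r)\<^sup>2)) (at r)"
proof -
  have "(W has_real_derivative k r / co r *
     (((si r)\<^sup>2 - (co r)\<^sup>2) * (real n + 1 + (co r)\<^sup>2) + 2 * (co r)\<^sup>2 * (si r)\<^sup>2)) (at r)"
    unfolding W_def[abs_def] using co_pos[of r]
    by (auto intro!: derivative_eq_intros co_deriv[OF assms] si_deriv[OF assms])
       (simp add: field_simps power2_eq_square)
  then show ?thesis unfolding barrier_slope_def si2 by (simp add: algebra_simps)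
qed

lemma F_deriv:
  assumes "r0 < r" "r \<le> x"
  shows "(F has_real_derivative W r * k r / co r) (at r)"
  unfolding F_def[abs_def] W_def using co_pos[of r]
  by (auto intro!: derivative_eq_intros co_deriv[OF assms])
     (simp add: field_simps power2_eq_square power3_eq_cube)

text \<open>\<open>Z\<close> is the comparison of \<open>T / (2 D)\<close> with \<open>W\<close>,
  cleared of the denominator. Substituting \<open>k = \<psi> - D\<close> and
  \<open>S = n \<psi> - D\<close> splits the source exactly into the excess, weighted by
  \<open>\<psi>\<close>, and the feedback, weighted by \<open>D\<close>.\<close>

lemma Z_deriv:
  assumes "r0 < r" "r \<le> x"
  shows "(Z has_real_derivative
     2 * D r / co r * (\<psi> r * barrier_excess (real n) ((co r)\<^sup>2) + D r * barrier_feedback (real n) ((co r)\<^sup>2))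
     + Z r * (W r * k r / co r + 1 / r)) (at r)"
proof -
  note a = arc_facts[OF assms]
  let ?u = "(co r)\<^sup>2" and ?f = "real n + 1 + (co r)\<^sup>2"
  have Wr: "W r / r = - co r * ?f * \<psi> r"
    by (simp add: W_def \<psi>_def)
  have W2: "(W r)\<^sup>2 = ?u * (1 - ?u) * ?f\<^sup>2"
    by (simp add: W_def power_mult_distrib si2)
  have "(Z has_real_derivative
      2 * (k r / co r * barrier_slope (real n) ?u) * D r
      + 2 * W r * (- real n * D r / r - k r * T r / (2 * co r))
      - (2 * S r * D r / co r + T r / r)) (at r)"
    unfolding Z_def[abs_def]
    by (auto intro!: derivative_eq_intros W_deriv[OF assms] D_deriv[OF assms] T_deriv[OF assms])
  also have "2 * (k r / co r * barrier_slope (real n) ?u) * D r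
      + 2 * W r * (- real n * D r / r - k r * T r / (2 * co r))
      - (2 * S r * D r / co r + T r / r)
    = 2 * D r / co r * (k r * barrier_slope (real n) ?u - (W r)\<^sup>2 * k r - S r
        - (real n + 1) * co r * (W r / r)) + Z r * (W r * k r / co r + 1 / r)"
    using a co_pos[of r] by (simp add: Z_def field_simps power2_eq_square)
  also have "k r * barrier_slope (real n) ?u - (W r)\<^sup>2 * k r - S r - (real n + 1) * co r * (W r / r)
    = \<psi> r * barrier_excess (real n) ?u + D r * barrier_feedback (real n) ?u"
    unfolding Wr W2 k_eq S_eq barrier_excess_def barrier_feedback_def by algebra
  finally show ?thesis .
qed

section \<open>Initial values at the vertical tangent\<close>

lemma limits:
  shows co_lim: "(co \<longlongrightarrow> 0) (at_right r0)" and si_lim: "(si \<longlongrightarrow> 1) (at_right r0)"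
    and g_lim: "(g \<longlongrightarrow> 0) (at_right r0)"
proof -
  have "(angle g \<longlongrightarrow> pi / 2) (at_right r0)"
    using solution filterlim_compose[OF tendsto_arctan_at_top]
    by (auto simp: shrinker_solution_def angle_def[abs_def])
  from tendsto_cos[OF this] tendsto_sin[OF this]
  show "(co \<longlongrightarrow> 0) (at_right r0)" "(si \<longlongrightarrow> 1) (at_right r0)"
    by (simp_all add: co_def[abs_def] si_def[abs_def])
  show "(g \<longlongrightarrow> 0) (at_right r0)"
    using solution by (auto simp: shrinker_solution_def continuous_within)
qed

lemma r0_neg: "r0 < 0" using r0_less_x x_neg by simp

lemma psi_lim: "(\<psi> \<longlongrightarrow> - 1 / r0) (at_right r0)"
  unfolding \<psi>_def[abs_def] using r0_neg by (auto intro!: tendsto_eq_intros si_lim)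

lemma S_lim: "(S \<longlongrightarrow> - r0 / 2) (at_right r0)"
  unfolding S_def[abs_def] by (auto intro!: tendsto_eq_intros si_lim co_lim g_lim)

lemma T_lim: "(T \<longlongrightarrow> 0) (at_right r0)"
  unfolding T_def[abs_def] by (auto intro!: tendsto_eq_intros si_lim co_lim g_lim)

text \<open>This equals \<open>(r0\<^sup>2 - 2 n) / (2 r0)\<close> and so vanishes exactly when
  \<open>r0\<close> is the starting point of the sphere.\<close>

definition "D0 = - real n / r0 + r0 / 2"

lemma D_lim: "(D \<longlongrightarrow> D0) (at_right r0)"
  unfolding D_def[abs_def] D0_def by (auto intro!: tendsto_eq_intros psi_lim S_lim)

lemma Z_lim: "(Z \<longlongrightarrow> 0) (at_right r0)"
  unfolding Z_def[abs_def] W_def[abs_def]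
  by (auto intro!: tendsto_eq_intros si_lim co_lim D_lim T_lim)

lemma F_lim: "(F \<longlongrightarrow> 0) (at_right r0)"
  unfolding F_def[abs_def] by (auto intro!: tendsto_eq_intros co_lim)

section \<open>Propagation of signs from \<open>r0\<close>\<close>

text \<open>The factor \<open>\<epsilon>\<close>, later 1 or -1, treats both signs of
  \<open>D\<close> at once. The derivative of \<open>T / (- r)\<close> is a nonnegative multiple of
  \<open>D\<close> because \<open>S \<ge> 0\<close>, and \<open>T\<close> starts at 0.\<close>

lemma T_sign:
  assumes r1: "r0 < r1" "r1 \<le> x" and D: "\<And>r. r0 < r \<Longrightarrow> r < r1 \<Longrightarrow> 0 \<le> \<epsilon> * D r"
  shows "0 \<le> \<epsilon> * T r1"
proof -
  have "0 \<le> \<epsilon> * T r1 / (- r1)"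
  proof (rule left_limit_le_of_deriv_nonneg[OF r1(1)])
    show "((\<lambda>r. \<epsilon> * T r / (- r)) \<longlongrightarrow> 0) (at_right r0)"
      using r0_neg by (auto intro!: tendsto_eq_intros T_lim)
  next
    fix r assume r: "r0 < r" "r \<le> r1"
    then have r': "r \<le> x" using r1 by simp
    show "((\<lambda>r. \<epsilon> * T r / (- r)) has_real_derivative (\<epsilon> * D r) * (2 * S r / (co r * (- r)))) (at r)"
      using arc_facts[OF r(1) r'] co_pos[of r]
      by (auto intro!: derivative_eq_intros T_deriv[OF r(1) r'] simp: field_simps)
  next
    fix r assume r: "r0 < r" "r < r1"
    then have r': "r \<le> x" using r1 by simp
    show "0 \<le> (\<epsilon> * D r) * (2 * S r / (co r * (- r)))"
      using arc_facts[OF r(1) r'] co_pos[of r] S_nonneg[OF r(1) r']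
      by (intro mult_nonneg_nonneg[OF D[OF r]] divide_nonneg_nonneg)
        (auto intro: mult_nonneg_nonpos less_imp_le)
  qed
  then show ?thesis using arc_facts[OF r1] by (simp add: divide_le_0_iff)
qed

text \<open>From \<open>\<psi>' = - D / r\<close> with \<open>r < 0\<close>. At the end this
  compares \<open>sin \<phi>\<close> with its value on the sphere.\<close>

lemma psi_sign:
  assumes r1: "r0 < r1" "r1 \<le> x" and D: "\<And>r. r0 < r \<Longrightarrow> r < r1 \<Longrightarrow> 0 \<le> \<epsilon> * D r"
  shows "\<epsilon> * (- 1 / r0) \<le> \<epsilon> * \<psi> r1"
proof (rule left_limit_le_of_deriv_nonneg[OF r1(1)])
  show "((\<lambda>r. \<epsilon> * \<psi> r) \<longlongrightarrow> \<epsilon> * (- 1 / r0)) (at_right r0)"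
    by (intro tendsto_intros psi_lim)
next
  fix r assume r: "r0 < r" "r \<le> r1"
  then have r': "r \<le> x" using r1 by simp
  show "((\<lambda>r. \<epsilon> * \<psi> r) has_real_derivative (\<epsilon> * D r) / (- r)) (at r)"
    by (auto intro!: derivative_eq_intros psi_deriv[OF r(1) r'])
next
  fix r assume r: "r0 < r" "r < r1"
  then show "0 \<le> (\<epsilon> * D r) / (- r)"
    using arc_facts[of r] D[OF r] r1 by (intro divide_nonneg_nonneg) auto
qed

text \<open>Two integrations: the barrier inequality first gives \<open>Z\<close> the sign of
  \<open>\<epsilon>\<close>, and then \<open>D\<close> times its integrating factor moves away from
  0, so \<open>r1\<close> cannot be a zero of \<open>D\<close>.\<close>

lemma D_sign_at:
  assumes r1: "r0 < r1" "r1 \<le> x"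
    and D: "\<And>r. r0 < r \<Longrightarrow> r < r1 \<Longrightarrow> 0 \<le> \<epsilon> * D r"
    and k: "\<And>r. r0 < r \<Longrightarrow> r < r1 \<Longrightarrow> 0 \<le> k r"
    and ex: "\<And>r. r0 < r \<Longrightarrow> r < r1 \<Longrightarrow>
      0 \<le> \<psi> r * barrier_excess (real n) ((co r)\<^sup>2) + D r * barrier_feedback (real n) ((co r)\<^sup>2)"
    and D0: "0 < \<epsilon> * D0"
  shows "0 < \<epsilon> * D r1"
proof -
  let ?X = "\<lambda>r. \<psi> r * barrier_excess (real n) ((co r)\<^sup>2) + D r * barrier_feedback (real n) ((co r)\<^sup>2)"
  have Z: "0 \<le> \<epsilon> * Z y" if y: "r0 < y" "y < r1" for y
  proof -
    have "0 \<le> \<epsilon> * Z y * exp (- F y) / (- y)"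
    proof (rule left_limit_le_of_deriv_nonneg[OF y(1)])
      show "((\<lambda>r. \<epsilon> * Z r * exp (- F r) / (- r)) \<longlongrightarrow> 0) (at_right r0)"
        using r0_neg by (auto intro!: tendsto_eq_intros Z_lim F_lim)
    next
      fix r assume r: "r0 < r" "r \<le> y"
      then have r': "r \<le> x" using y r1 by simp
      show "((\<lambda>r. \<epsilon> * Z r * exp (- F r) / (- r)) has_real_derivative
          (\<epsilon> * D r) * (exp (- F r) / (- r) * (2 / co r * ?X r))) (at r)"
        using arc_facts[OF r(1) r'] co_pos[of r]
        by (auto intro!: derivative_eq_intros Z_deriv[OF r(1) r'] F_deriv[OF r(1) r'])
          (simp add: field_simps)
    next
      fix r assume r: "r0 < r" "r < y"
      then show "0 \<le> (\<epsilon> * D r) * (exp (- F r) / (- r) * (2 / co r * ?X r))"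
        using arc_facts[of r] co_pos[of r] ex[of r] y r1
        by (intro mult_nonneg_nonneg[OF D] mult_nonneg_nonneg divide_nonneg_nonneg) auto
    qed
    moreover have "0 < exp (- F y) / (- y)"
      using arc_facts(1)[of y] y r1 by (intro divide_pos_pos) auto
    ultimately show ?thesis
      by (metis times_divide_eq_right zero_le_mult_iff not_le less_le_not_le)
  qed
  \<comment> \<open>The term \<open>- n D / r\<close> of \<open>D'\<close> is cancelled by the power
    of \<open>- r\<close>; the exponential contributes \<open>D W k / co\<close>, which combines
    with \<open>- k T / (2 co)\<close> to \<open>k Z / (2 co)\<close>.\<close>
  have "\<epsilon> * D0 * (- r0) ^ n \<le> \<epsilon> * D r1 * (- r1) ^ n * exp (F r1)"
  proof (rule left_limit_le_of_deriv_nonneg[OF r1(1)])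
    show "((\<lambda>r. \<epsilon> * D r * (- r) ^ n * exp (F r)) \<longlongrightarrow> \<epsilon> * D0 * (- r0) ^ n) (at_right r0)"
      by (auto intro!: tendsto_eq_intros D_lim F_lim)
  next
    fix r assume r: "r0 < r" "r \<le> r1"
    then have r': "r \<le> x" using r1 by simp
    note neg = arc_facts(1)[OF r(1) r']
    show "((\<lambda>r. \<epsilon> * D r * (- r) ^ n * exp (F r)) has_real_derivative
       (\<epsilon> * Z r) * ((- r) ^ n * exp (F r) * (k r / (2 * co r)))) (at r)"
      by (rule power_minus_deriv[OF neg] derivative_eq_intros D_deriv[OF r(1) r'] F_deriv[OF r(1) r'] refl)+
        (use neg co_pos[of r] in \<open>simp add: Z_def field_simps\<close>)
  next
    fix r assume r: "r0 < r" "r < r1"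
    then show "0 \<le> (\<epsilon> * Z r) * ((- r) ^ n * exp (F r) * (k r / (2 * co r)))"
      using arc_facts[of r] co_pos[of r] k[of r] r1
      by (intro mult_nonneg_nonneg[OF Z] mult_nonneg_nonneg divide_nonneg_nonneg) auto
  qed
  moreover have "0 < \<epsilon> * D0 * (- r0) ^ n" using D0 r0_neg by simp
  ultimately have "0 < \<epsilon> * D r1 * ((- r1) ^ n * exp (F r1))" by (simp add: mult.assoc)
  moreover have "0 < (- r1) ^ n * exp (F r1)" using arc_facts[OF r1] by simp
  ultimately show ?thesis by (simp add: zero_less_mult_iff)
qed

section \<open>Start to the right of \<open>- sqrt (2 n)\<close>: \<open>D\<close> stays
  positive\<close>

text \<open>At a zero of \<open>k\<close> its derivative has the sign of \<open>- D\<close>, so \<open>k\<close> cannot return to positive values.\<close>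

lemma k_pos_before:
  assumes r1: "r0 < r1" "r1 \<le> x" and D: "\<And>r. r0 < r \<Longrightarrow> r < r1 \<Longrightarrow> 0 < D r"
    and k: "0 < k r1" and r: "r0 < r" "r < r1"
  shows "0 < k r"
proof (rule ccontr)
  assume "\<not> 0 < k r"
  then have "\<exists>y. r \<le> y \<and> y < r1 \<and> k y = 0 \<and> (\<forall>z. y < z \<and> z \<le> r1 \<longrightarrow> 0 < k z)"
    using r r1 k by (intro ex_last_zero) (auto intro!: DERIV_isCont[OF k_deriv])
  then obtain y where y: "r \<le> y" "y < r1" "k y = 0" and after: "\<And>z. y < z \<Longrightarrow> z \<le> r1 \<Longrightarrow> 0 < k z"
    by auto
  have y': "r0 < y" "y \<le> x" using y r r1 by auto
  have "(real n - 1) * D y / y + k y * T y / (2 * co y) < 0"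
    using y arc_facts(1)[OF y'] D[OF y'(1) y(2)] n_ge_2 by (simp add: divide_pos_neg)
  then obtain d where d: "d > 0" "\<And>h. 0 < h \<Longrightarrow> h < d \<Longrightarrow> k (y + h) < k y"
    using DERIV_neg_dec_right[OF k_deriv[OF y']] by auto
  define h where "h = min (d / 2) (r1 - y)"
  have "0 < h" "h < d" "y + h \<le> r1" using d(1) y by (auto simp: h_def)
  then show False using d(2)[of h] after[of "y + h"] y by auto
qed

text \<open>
  The bound \<open>d' \<le> n d tan \<alpha> / (1 - d)\<close> for \<open>d = D / \<psi>\<close> integrates to the monotonicity of
  \<open>d exp (- d) cos\<^sup>n \<alpha>\<close>.
\<close>

lemma D_over_psi_bound:
  assumes r1: "r0 < r1" "r1 \<le> x" and D: "\<And>r. r0 < r \<Longrightarrow> r < r1 \<Longrightarrow> 0 < D r"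
    and k: "\<And>r. r0 < r \<Longrightarrow> r < r1 \<Longrightarrow> 0 < k r"
    and y: "r0 < y" "y < r1"
  shows "D y / \<psi> y * exp (- (D y / \<psi> y)) * si y ^ n \<le> D0 * (- r0) * exp (- (D0 * (- r0)))"
proof -
  have psi: "0 < \<psi> r" if "r0 < r" "r < r1" for r
    using D[OF that] k[OF that] k_eq[of r] by simp
  have "- (D0 * (- r0) * exp (- (D0 * (- r0)))) \<le> - (D y / \<psi> y * exp (- (D y / \<psi> y)) * si y ^ n)"
  proof (rule left_limit_le_of_deriv_nonneg[OF y(1)])
    have lim: "((\<lambda>r. D r / \<psi> r) \<longlongrightarrow> D0 * (- r0)) (at_right r0)"
      using r0_neg by (auto intro!: tendsto_eq_intros D_lim psi_lim)
    have "((\<lambda>r. - (D r / \<psi> r * exp (- (D r / \<psi> r)) * si r ^ n)) \<longlongrightarrow>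
        - (D0 * (- r0) * exp (- (D0 * (- r0))) * 1 ^ n)) (at_right r0)"
      by (intro tendsto_minus tendsto_mult tendsto_exp tendsto_power lim si_lim)
    then show "((\<lambda>r. - (D r / \<psi> r * exp (- (D r / \<psi> r)) * si r ^ n)) \<longlongrightarrow>
        - (D0 * (- r0) * exp (- (D0 * (- r0))))) (at_right r0)"
      by simp
  next
    fix r assume r: "r0 < r" "r \<le> y"
    then have r': "r \<le> x" and r'': "r < r1" using y r1 by auto
    note neg = arc_facts(1)[OF r(1) r'] and p = psi[OF r(1) r'']
    define d where "d = D r / \<psi> r"
    have Dd: "D r = d * \<psi> r" using p by (simp add: d_def)
    have kd: "k r = \<psi> r * (1 - d)" by (simp add: k_eq Dd algebra_simps)
    have sr: "si r = - r * \<psi> r" using neg by (simp add: \<psi>_def)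
    have 1: "((\<lambda>r. D r / \<psi> r) has_real_derivative
        - real n * d / r - k r * T r / (2 * co r * \<psi> r) + d\<^sup>2 / r) (at r)"
      using p neg co_pos[of r]
      by (auto intro!: derivative_eq_intros D_deriv[OF r(1) r'] psi_deriv[OF r(1) r'])
         (simp add: Dd field_simps power2_eq_square)
    have 2: "((\<lambda>r. si r ^ n) has_real_derivative real n * si r ^ n * (1 - d) / r) (at r)"
    proof -
      have "((\<lambda>r. si r ^ n) has_real_derivative real n * si r ^ (n - 1) * (- k r)) (at r)"
        by (auto intro!: derivative_eq_intros si_deriv[OF r(1) r'])
      moreover have "si r ^ n = si r ^ (n - 1) * si r"
        using n_ge_2 by (metis power_minus_mult zero_less_numeral less_le_trans)
      moreover have "- k r = si r * ((1 - d) / r)" using neg by (simp add: kd sr)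
      ultimately show ?thesis by (simp add: mult.assoc)
    qed
    \<comment> \<open>The two terms \<open>n d / r\<close>, from \<open>d\<close> and from
      \<open>si ^ n\<close>, cancel; the rest has a sign because \<open>T \<ge> 0\<close> and
      \<open>r < 0\<close>.\<close>
    show "((\<lambda>r. - (D r / \<psi> r * exp (- (D r / \<psi> r)) * si r ^ n)) has_real_derivative
        exp (- (D r / \<psi> r)) * si r ^ n * (k r / \<psi> r) *
        (k r * T r / (2 * co r * \<psi> r) + (D r / \<psi> r)\<^sup>2 / (- r))) (at r)"
      by (rule 1 2 derivative_eq_intros refl)+
        (use p neg co_pos[of r] in \<open>unfold d_def[symmetric], simp add: kd field_simps power2_eq_square\<close>)
  next
    fix r assume r: "r0 < r" "r < y"
    then have r': "r \<le> x" and r'': "r < r1" using y r1 by auto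
    have "0 \<le> 1 * T r"
      using r r' r'' D by (intro T_sign) (auto intro: less_imp_le)
    then show "0 \<le> exp (- (D r / \<psi> r)) * si r ^ n * (k r / \<psi> r) *
        (k r * T r / (2 * co r * \<psi> r) + (D r / \<psi> r)\<^sup>2 / (- r))"
      using arc_facts(1)[OF r(1) r'] psi[OF r(1) r''] k[OF r(1) r''] co_pos[of r] si_nonneg[OF r(1) r']
      by (intro mult_nonneg_nonneg divide_nonneg_nonneg add_nonneg_nonneg) auto
  qed
  then show ?thesis by simp
qed

text \<open>A first zero is excluded by \<open>D_sign_at\<close>. For \<open>u \<ge> 1/2\<close> the
  feedback is harmless; for \<open>u < 1/2\<close>, where \<open>si\<close> is bounded below,
  \<open>D_over_psi_bound\<close> keeps \<open>D / \<psi>\<close> below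
  \<open>\<eta>\<close>.\<close>

lemma D_pos:
  assumes \<eta>: "0 < \<eta>" "\<And>u. 0 \<le> u \<Longrightarrow> u \<le> 1 \<Longrightarrow>
      \<eta> * \<bar>barrier_feedback (real n) u\<bar> \<le> barrier_excess (real n) u"
    and D0: "0 < D0" and small: "3 * 2 ^ n * (D0 * (- r0)) \<le> \<eta>"
    and r: "r0 < r" "r \<le> x"
  shows "0 < D r"
proof (rule ccontr)
  assume "\<not> 0 < D r"
  moreover have "\<forall>\<^sub>F r in at_right r0. 0 < D r" using order_tendstoD(1)[OF D_lim D0] .
  moreover have "isCont D y" if "r0 < y" "y \<le> r" for y
    using that r by (auto intro!: DERIV_isCont[OF D_deriv])
  ultimately have "\<exists>r1. r0 < r1 \<and> r1 \<le> r \<and> D r1 = 0 \<and> (\<forall>y. r0 < y \<and> y < r1 \<longrightarrow> 0 < D y)"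
    using r by (intro ex_first_zero) auto
  then obtain r1 where r1: "r0 < r1" "r1 \<le> r" "D r1 = 0"
    and before: "\<And>y. r0 < y \<Longrightarrow> y < r1 \<Longrightarrow> 0 < D y"
    by blast
  have r1x: "r1 \<le> x" using r1 r by simp
  have "0 \<le> 1 * T r1" using r1 r1x before by (intro T_sign) (auto intro: less_imp_le)
  \<comment> \<open>With \<open>T \<ge> 0\<close> the identity forces
    \<open>2 S \<psi> \<ge> 1\<close>, hence \<open>\<psi> > 0\<close>, and
    \<open>k = \<psi>\<close> where \<open>D = 0\<close>.\<close>
  then have "T r1 * co r1 / r1 \<le> 0"
    using arc_facts(1)[OF r1(1) r1x] co_pos[of r1] by (simp add: divide_nonneg_neg)
  then have "\<psi> r1 \<noteq> 0"
    using T_identity[OF r1(1) r1x] by auto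
  then have "0 < k r1"
    using psi_nonneg[OF r1(1) r1x] r1 by (simp add: k_eq)
  then have k: "0 < k y" if "r0 < y" "y < r1" for y
    using k_pos_before[OF r1(1) r1x before] that by blast
  have "0 < 1 * D r1"
  proof (rule D_sign_at[OF r1(1) r1x])
    fix y assume y: "r0 < y" "y < r1"
    define d where "d = D y / \<psi> y"
    have p: "0 < \<psi> y" using before[OF y] k[OF y] by (simp add: k_eq)
    have d: "0 < d" "d < 1"
      using p before[OF y] k[OF y] by (auto simp: d_def k_eq)
    let ?u = "(co y)\<^sup>2"
    have u: "0 \<le> ?u" "?u \<le> 1" using co2_le_1 by auto
    note E = barrier_excess_pos[OF _ u, of "real n"]
    show "0 \<le> \<psi> y * barrier_excess (real n) ?u + D y * barrier_feedback (real n) ?u"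
    proof (cases "1 / 2 \<le> ?u")
      case True
      then show ?thesis
        using barrier_feedback_nonneg[OF _ True u(2), of "real n"] E n_ge_2 p before[OF y]
        by (intro add_nonneg_nonneg mult_nonneg_nonneg) auto
    next
      case False
      \<comment> \<open>The constant \<open>3 * 2 ^ n\<close> arises from
        \<open>si \<ge> 1/2\<close> and from \<open>exp (- d) \<ge> 1/3\<close>, valid since
        \<open>d < 1\<close>.\<close>
      have "(1 / 2)\<^sup>2 \<le> (si y)\<^sup>2" using False unfolding si2 by (simp add: power_one_over)
      then have "1 / 2 \<le> si y"
        by (rule power2_le_imp_le) (use si_nonneg[of y] y r1x in auto)
      then have sn: "(1 / 2) ^ n \<le> si y ^ n" by (intro power_mono) auto
      have "1 / 3 \<le> exp (- 1 :: real)"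
        using exp_le by (simp add: exp_minus field_simps)
      also have "\<dots> \<le> exp (- d)" using d by simp
      finally have "d * (1 / 3) * (1 / 2) ^ n \<le> d * exp (- d) * si y ^ n"
        using sn d by (intro mult_mono) auto
      also have "\<dots> \<le> D0 * (- r0) * exp (- (D0 * (- r0)))"
        unfolding d_def using D_over_psi_bound[OF r1(1) r1x before k y] .
      also have "\<dots> \<le> D0 * (- r0) * 1"
        using mult_pos_pos[OF D0, of "- r0"] r0_neg by (intro mult_left_mono) auto
      finally have "d \<le> 3 * 2 ^ n * (D0 * (- r0))"
        by (simp add: field_simps power_one_over)
      then have "d \<le> \<eta>" using small by simp
      have "- (D y * barrier_feedback (real n) ?u) \<le> \<bar>D y * barrier_feedback (real n) ?u\<bar>"
        by simp
      also have "\<dots> = \<psi> y * (d * \<bar>barrier_feedback (real n) ?u\<bar>)"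
        using p before[OF y] by (simp add: d_def abs_mult)
      also have "\<dots> \<le> \<psi> y * (\<eta> * \<bar>barrier_feedback (real n) ?u\<bar>)"
        using p \<open>d \<le> \<eta>\<close> by (intro mult_left_mono mult_right_mono) auto
      also have "\<dots> \<le> \<psi> y * barrier_excess (real n) ?u"
        using p \<eta>(2)[OF u] by (intro mult_left_mono) auto
      finally show ?thesis by simp
    qed
  qed (use before k D0 in \<open>auto intro: less_imp_le\<close>)
  then show False using r1 by simp
qed

section \<open>Start to the left of \<open>- sqrt (2 n)\<close>: \<open>D\<close> stays
  negative\<close>

text \<open>If \<open>- D \<le> \<eta> \<psi>\<close> up to the first zero \<open>r1\<close>,
  \<open>D_sign_at\<close> applies. Otherwise equality first occurs at some \<open>r2\<close>, which
  the last smallness condition forces to lie within \<open>\<eta> / (- r0) ^ 3\<close> of the axis;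
  a power of \<open>- r\<close> then bounds \<open>- D\<close> from below up to
  \<open>r1\<close>.\<close>

lemma D_neg:
  assumes \<eta>: "0 < \<eta>" "\<eta> \<le> 1" "\<And>u. 0 \<le> u \<Longrightarrow> u \<le> 1 \<Longrightarrow>
      \<eta> * \<bar>barrier_feedback (real n) u\<bar> \<le> barrier_excess (real n) u"
    and D0: "D0 < 0" and r0_le: "2 \<le> - r0" and small: "D0 * r0 < \<eta>"
      "- D0 * (- r0) ^ (n + 2) / \<eta> < (\<eta> / (- r0) ^ 3) ^ (n + 1)"
    and r: "r0 < r" "r \<le> x"
  shows "D r < 0"
proof (rule ccontr)
  assume "\<not> D r < 0"
  moreover have "\<forall>\<^sub>F r in at_right r0. 0 < - D r"
    using order_tendstoD(2)[OF D_lim D0] by simp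
  moreover have "isCont (\<lambda>r. - D r) y" if "r0 < y" "y \<le> r" for y
    using that r by (auto intro!: continuous_intros DERIV_isCont[OF D_deriv])
  ultimately obtain r1 where r1: "r0 < r1" "r1 \<le> r" "D r1 = 0"
    and before: "\<And>y. r0 < y \<Longrightarrow> y < r1 \<Longrightarrow> D y < 0"
    using ex_first_zero[of r0 r "\<lambda>r. - D r"] r by auto
  have r1x: "r1 \<le> x" using r1 r by simp
  have k_nonneg: "0 \<le> k y" if "r0 < y" "y < r1" for y
    using psi_nonneg[of y] before[OF that] that r1x by (simp add: k_eq)
  have T: "T y \<le> 0" if "r0 < y" "y \<le> r1" for y
    using T_sign[of y "-1"] that r1x before[THEN less_imp_le] by simp
  show False
  proof (cases "\<forall>y. r0 < y \<and> y < r1 \<longrightarrow> - D y \<le> \<eta> * \<psi> y")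
    case True
    have "0 < (-1) * D r1"
    proof (rule D_sign_at[OF r1(1) r1x])
      fix y assume y: "r0 < y" "y < r1"
      let ?u = "(co y)\<^sup>2"
      have u: "0 \<le> ?u" "?u \<le> 1" using co2_le_1 by auto
      have p: "0 \<le> \<psi> y" using psi_nonneg[of y] y r1x by simp
      have "- (D y * barrier_feedback (real n) ?u) \<le> - D y * \<bar>barrier_feedback (real n) ?u\<bar>"
        using mult_left_mono[of "barrier_feedback (real n) ?u" "\<bar>barrier_feedback (real n) ?u\<bar>" "- D y"]
          before[OF y] by simp
      also have "\<dots> \<le> \<eta> * \<psi> y * \<bar>barrier_feedback (real n) ?u\<bar>"
        using True y by (intro mult_right_mono) auto
      also have "\<dots> \<le> \<psi> y * barrier_excess (real n) ?u"
        using mult_left_mono[OF \<eta>(3)[OF u] p] by (simp add: ac_simps)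
      finally show "0 \<le> \<psi> y * barrier_excess (real n) ?u + D y * barrier_feedback (real n) ?u"
        by simp
    qed (use before k_nonneg D0 in \<open>auto intro: less_imp_le\<close>)
    then show False using r1 by simp
  next
    case False
    then obtain y where y: "r0 < y" "y < r1" "\<eta> * \<psi> y < - D y" by auto
    have "((\<lambda>r. \<eta> * \<psi> r + D r) \<longlongrightarrow> \<eta> * (- 1 / r0) + D0) (at_right r0)"
      by (intro tendsto_intros psi_lim D_lim)
    moreover have "0 < \<eta> * (- 1 / r0) + D0" using small(1) r0_neg by (simp add: field_simps)
    ultimately have "\<forall>\<^sub>F r in at_right r0. 0 < \<eta> * \<psi> r + D r" by (rule order_tendstoD(1))
    moreover have "isCont (\<lambda>r. \<eta> * \<psi> r + D r) z" if "r0 < z" "z \<le> y" for z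
      using that y r1x by (auto intro!: continuous_intros DERIV_isCont[OF D_deriv] DERIV_isCont[OF psi_deriv])
    ultimately obtain r2 where r2: "r0 < r2" "r2 \<le> y" "\<eta> * \<psi> r2 + D r2 = 0"
      and before2: "\<And>z. r0 < z \<Longrightarrow> z < r2 \<Longrightarrow> 0 < \<eta> * \<psi> z + D z"
      using ex_first_zero[of r0 y "\<lambda>r. \<eta> * \<psi> r + D r"] y by auto
    have r2x: "r2 \<le> x" and r2r1: "r2 < r1" using r2 y r1x by auto
    have r2neg: "r2 < 0" using arc_facts(1)[OF r2(1) r2x] .
    \<comment> \<open>A lower bound for \<open>\<psi> r2\<close>, hence for \<open>- D r2\<close>,
      linear in \<open>- r2\<close>; it follows from \<open>- D < \<eta> \<psi> \<le> \<psi>\<close>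
      before \<open>r2\<close>.\<close>
    have psi_lower: "1 / r0\<^sup>2 \<le> \<psi> r2 / (- r2)"
    proof (rule left_limit_le_of_deriv_nonneg[OF r2(1)])
      show "((\<lambda>r. \<psi> r / (- r)) \<longlongrightarrow> 1 / r0\<^sup>2) (at_right r0)"
        using r0_neg by (auto intro!: tendsto_eq_intros psi_lim simp: power2_eq_square)
    next
      fix z assume z: "r0 < z" "z \<le> r2"
      then have z': "z \<le> x" using r2x by simp
      show "((\<lambda>r. \<psi> r / (- r)) has_real_derivative (\<psi> z + D z) / z\<^sup>2) (at z)"
        using arc_facts(1)[OF z(1) z']
        by (auto intro!: derivative_eq_intros psi_deriv[OF z(1) z'] simp: field_simps power2_eq_square)
    next
      fix z assume z: "r0 < z" "z < r2"
      have "\<eta> * \<psi> z \<le> 1 * \<psi> z"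
        using \<eta>(2) psi_nonneg[of z] z r2x by (intro mult_right_mono) auto
      then show "0 \<le> (\<psi> z + D z) / z\<^sup>2" using before2[OF z] by simp
    qed
    \<comment> \<open>An upper bound for \<open>- D r2\<close> of order
      \<open>(- r2) ^ (- n)\<close>. Together with the lower bound it makes
      \<open>(- r2) ^ (n + 1)\<close> small with \<open>D0\<close>.\<close>
    have "D0 * (- r0) ^ n \<le> D r2 * (- r2) ^ n"
    proof (rule left_limit_le_of_deriv_nonneg[OF r2(1)])
      show "((\<lambda>r. D r * (- r) ^ n) \<longlongrightarrow> D0 * (- r0) ^ n) (at_right r0)"
        by (auto intro!: tendsto_eq_intros D_lim)
    next
      fix z assume z: "r0 < z" "z \<le> r2"
      then have z': "z \<le> x" using r2x by simp
      note neg = arc_facts(1)[OF z(1) z']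
      show "((\<lambda>r. D r * (- r) ^ n) has_real_derivative
          (- z) ^ n * (k z * (- T z) / (2 * co z))) (at z)"
        by (rule power_minus_deriv[OF neg] derivative_eq_intros D_deriv[OF z(1) z'] refl)+
          (use neg co_pos[of z] in \<open>simp add: field_simps\<close>)
    next
      fix z assume z: "r0 < z" "z < r2"
      then show "0 \<le> (- z) ^ n * (k z * (- T z) / (2 * co z))"
        using k_nonneg[of z] T[of z] co_pos[of z] arc_facts(1)[of z] r2r1 r1x
        by (intro mult_nonneg_nonneg divide_nonneg_nonneg) auto
    qed
    then have "\<eta> * \<psi> r2 * (- r2) ^ n \<le> - D0 * (- r0) ^ n"
      using r2(3) by (simp add: algebra_simps add_eq_0_iff)
    moreover have psi2: "- r2 / r0\<^sup>2 \<le> \<psi> r2"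
      using psi_lower r2neg r0_neg by (simp add: field_simps)
    then have "\<eta> * (- r2 / r0\<^sup>2) * (- r2) ^ n \<le> \<eta> * \<psi> r2 * (- r2) ^ n"
      using \<eta>(1) r2neg by (intro mult_right_mono mult_left_mono) auto
    ultimately have "\<eta> * (- r2) ^ (n + 1) / r0\<^sup>2 \<le> - D0 * (- r0) ^ n"
      by simp
    then have "\<eta> * (- r2) ^ (n + 1) \<le> - D0 * (- r0) ^ n * r0\<^sup>2"
      using r0_neg by (subst (asm) pos_divide_le_eq) auto
    also have "\<dots> = - D0 * (- r0) ^ (n + 2)" by (simp add: power_add power2_eq_square)
    finally have "(- r2) ^ (n + 1) \<le> - D0 * (- r0) ^ (n + 2) / \<eta>"
      using \<eta>(1) by (subst pos_le_divide_eq) (simp_all only: mult.commute)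
    then have "(- r2) ^ (n + 1) < (\<eta> / (- r0) ^ 3) ^ (n + 1)"
      using small(2) by linarith
    then have r2small: "- r2 < \<eta> / (- r0) ^ 3"
      by (rule power_less_imp_less_base) (use \<eta>(1) r0_neg in \<open>intro divide_nonneg_nonneg, auto\<close>)
    have r2half: "- r2 \<le> - r0 / 2"
    proof -
      have "1 \<le> (- r0) ^ 3" using r0_le by (intro one_le_power) simp
      then have "\<eta> / (- r0) ^ 3 \<le> 1"
        using \<eta>(2) by (subst divide_le_eq_1_pos) linarith+
      then show ?thesis using r2small r0_le by simp
    qed
    \<comment> \<open>This choice suffices because \<open>k \<le> S \<le> - r0 / 2\<close> gives
      \<open>k (- T) / (2 co) \<le> K (- z) / 2\<close>, whereas the subtracted power contributes
      \<open>K (n + 2) (- z)\<close>.\<close>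
    define K where "K = - r0"
    have gap: "- D r2 * (- r2) ^ n - K * (- r2) ^ (n + 2) \<le> - D r1 * (- r1) ^ n - K * (- r1) ^ (n + 2)"
    proof (rule DERIV_nonneg_imp_nondecreasing[where f = "\<lambda>r. - D r * (- r) ^ n - K * (- r) ^ (n + 2)"])
      show "r2 \<le> r1" using r2r1 by simp
      fix z assume z: "r2 \<le> z" "z \<le> r1"
      then have z': "r0 < z" "z \<le> x" using r2 r1x by auto
      note neg = arc_facts(1)[OF z']
      note Tz = T[OF z'(1) z(2)]
      have psi_le: "\<psi> z \<le> 1 / (- r0)"
        using psi_sign[OF z', of "-1"] before[THEN less_imp_le] z by simp
      have S_le: "S z \<le> - r0 / 2"
      proof -
        have "- (- r0 / 2) \<le> - S z"
        proof (rule left_limit_le_of_deriv_nonneg[OF z'(1)])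
          show "((\<lambda>r. - S r) \<longlongrightarrow> - (- r0 / 2)) (at_right r0)" by (intro tendsto_intros S_lim)
        next
          fix w assume w: "r0 < w" "w \<le> z"
          then have w': "w \<le> x" using z' by simp
          show "((\<lambda>r. - S r) has_real_derivative (k w * (- T w) / (2 * co w))) (at w)"
            by (auto intro!: derivative_eq_intros S_deriv[OF w(1) w'])
        next
          fix w assume w: "r0 < w" "w < z"
          then show "0 \<le> k w * (- T w) / (2 * co w)"
            using k_nonneg[of w] T[of w] co_pos[of w] z
            by (intro mult_nonneg_nonneg divide_nonneg_nonneg) auto
        qed
        then show ?thesis by simp
      qed
      have k_le: "k z \<le> - r0 / 2"
        using S_le mult_nonneg_nonneg[OF _ psi_nonneg[OF z'], of "real n - 1"] n_ge_2
        by (simp add: k_def)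
      \<comment> \<open>Close to the axis the tangent is far from vertical, so the bound on
        \<open>- T co\<close> from \<open>T_identity\<close> becomes one on
        \<open>- T / co\<close>.\<close>
      have "si z = - z * \<psi> z" using neg by (simp add: \<psi>_def)
      also have "\<dots> \<le> (- r0 / 2) * (1 / (- r0))"
        using psi_le r2half z neg r0_neg psi_nonneg[OF z'] by (intro mult_mono) auto
      also have "\<dots> = 1 / 2" using r0_neg by simp
      finally have "(si z)\<^sup>2 \<le> (1 / 2)\<^sup>2" using si_nonneg[OF z'] by (intro power_mono)
      then have co2: "1 / 2 \<le> (co z)\<^sup>2" unfolding si2 by (simp add: power_one_over)
      have "T z * co z / z \<le> 1"
        using T_identity[OF z'] S_nonneg[OF z'] psi_nonneg[OF z']
          mult_nonneg_nonneg[of "S z" "\<psi> z"] by linarith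
      then have "- T z * co z \<le> - z" using neg by (simp add: field_simps)
      then have "- T z / co z * (co z)\<^sup>2 \<le> - z" using co_pos[of z] by (simp add: power2_eq_square)
      moreover have "- T z / co z * (1 / 2) \<le> - T z / co z * (co z)\<^sup>2"
        using co2 Tz co_pos[of z] by (intro mult_left_mono) (auto simp: divide_nonpos_pos)
      ultimately have tz: "- T z / co z \<le> 2 * (- z)" by simp
      have "k z * (- T z) / (2 * co z) = k z * (- T z / co z) / 2" by simp
      also have "\<dots> \<le> (- r0 / 2) * (2 * (- z)) / 2"
        using k_le tz neg r0_neg Tz co_pos[of z]
        by (intro divide_right_mono mult_mono) (auto simp: divide_nonpos_pos)
      finally have main: "k z * (- T z) / (2 * co z) \<le> K * (- z) / 2" by (simp add: K_def)
      have "((\<lambda>r. - D r * (- r) ^ n - K * (- r) ^ (n + 2)) has_real_derivative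
         (- z) ^ n * (K * (real n + 2) * (- z) - k z * (- T z) / (2 * co z))) (at z)"
        by (rule power_minus_deriv[OF neg] derivative_eq_intros D_deriv[OF z'] refl)+
          (use neg co_pos[of z] in \<open>simp add: field_simps power_add power2_eq_square\<close>)
      moreover have "0 \<le> (- z) ^ n * (K * (real n + 2) * (- z) - k z * (- T z) / (2 * co z))"
      proof -
        have *: "K * (- z) * (1 / 2) \<le> K * (- z) * (real n + 2)"
          using neg r0_neg by (intro mult_left_mono) (auto simp: K_def mult_nonpos_nonpos)
        have "k z * (- T z) / (2 * co z) \<le> K * (real n + 2) * (- z)"
        proof -
          have "K * (- z) / 2 = K * (- z) * (1 / 2)" "K * (real n + 2) * (- z) = K * (- z) * (real n + 2)"
            by simp_all
          then show ?thesis using main * by linarith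
        qed
        then show ?thesis using neg by simp
      qed
      ultimately show "\<exists>y. ((\<lambda>r. - D r * (- r) ^ n - K * (- r) ^ (n + 2)) has_real_derivative y) (at z) \<and> 0 \<le> y"
        by blast
    qed
    have "- D r1 * (- r1) ^ n - K * (- r1) ^ (n + 2) \<le> 0"
    proof -
      have "0 \<le> K * (- r1) ^ (n + 2)"
        using r0_neg arc_facts(1)[OF r1(1) r1x]
        by (intro mult_nonneg_nonneg zero_le_power) (auto simp: K_def)
      then show ?thesis using r1(3) by simp
    qed
    moreover have "0 < - D r2 * (- r2) ^ n - K * (- r2) ^ (n + 2)"
    proof -
      \<comment> \<open>The cube in the bound on \<open>- r2\<close> is chosen so that a factor
        \<open>1 / r0\<^sup>2\<close> remains, matching the lower bound for
        \<open>\<psi> r2\<close>.\<close>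
      have "K * (- r2) < K * (\<eta> / (- r0) ^ 3)"
        using r2small r0_neg by (intro mult_strict_left_mono) (simp_all add: K_def)
      also have "\<dots> = \<eta> / r0\<^sup>2"
        using r0_neg by (simp add: K_def power2_eq_square power3_eq_cube)
      finally have "K * (- r2) * (- r2) < \<eta> / r0\<^sup>2 * (- r2)"
        using r2neg by (intro mult_strict_right_mono) auto
      also have "\<dots> \<le> \<eta> * \<psi> r2"
        using mult_left_mono[OF psi2, of \<eta>] \<eta>(1) by simp
      also have "\<dots> = - D r2" using r2(3) by simp
      finally have "0 < (- D r2 - K * (- r2)\<^sup>2) * (- r2) ^ n"
        using r2neg by (simp add: power2_eq_square)
      then show ?thesis by (simp add: algebra_simps power_add power2_eq_square)
    qed
    ultimately show False using gap by linarith
  qed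
qed

end

section \<open>Comparison with the sphere\<close>

lemma angle_sphere_profile:
  assumes "- sqrt (2 * real n) < r" "r < 0"
  shows "sin (angle (sphere_profile n) r) = - r / sqrt (2 * real n)"
proof -
  let ?h = "sphere_profile n r"
  have pos: "0 < 2 * real n - r\<^sup>2" by (rule sphere_profile_radicand_pos[OF assms])
  then have h: "0 < ?h" "?h\<^sup>2 = 2 * real n - r\<^sup>2" by (simp_all add: sphere_profile_def)
  have "1 + (- r / ?h)\<^sup>2 = 2 * real n / ?h\<^sup>2"
    using h by (simp add: power_divide add_divide_distrib field_simps)
  then have "sqrt (1 + (- r / ?h)\<^sup>2) = sqrt (2 * real n) / ?h"
    using h(1) by (simp add: real_sqrt_divide)
  then show ?thesis
    using h(1) by (simp add: angle_def deriv_sphere_profile[OF assms] sin_arctan)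
qed

lemma angle_less_iff_sin: "angle f r < angle h r \<longleftrightarrow> sin (angle f r) < sin (angle h r)"
  unfolding angle_def
  using arctan_bounded[of "deriv f r"] arctan_bounded[of "deriv h r"]
  by (intro sin_mono_less_eq[symmetric]) auto

theorem lemma11:
  fixes n :: nat
  assumes "n \<ge> 2"
  shows "(\<exists>\<delta>>0. \<forall>r0 c g. r0 < 0 \<longrightarrow>
            - sqrt (2 * real n) < r0 \<longrightarrow> r0 < - sqrt (2 * real n) + \<delta> \<longrightarrow>
            shrinker_solution n r0 c g \<longrightarrow>
            (\<forall>r \<in> portion r0 c g \<inter> portion (- sqrt (2 * real n)) 0 (sphere_profile n).
               angle g r > angle (sphere_profile n) r)) \<and>
         (\<exists>\<delta>>0. \<forall>r0 c g. r0 < 0 \<longrightarrow>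
            - sqrt (2 * real n) - \<delta> < r0 \<longrightarrow> r0 < - sqrt (2 * real n) \<longrightarrow>
            shrinker_solution n r0 c g \<longrightarrow>
            (\<forall>r \<in> portion r0 c g \<inter> portion (- sqrt (2 * real n)) 0 (sphere_profile n).
               angle g r < angle (sphere_profile n) r))"
proof -
  define R where "R = sqrt (2 * real n)"
  have R2: "R\<^sup>2 = 2 * real n" by (simp add: R_def)
  have "sqrt (2\<^sup>2) \<le> R" unfolding R_def using assms by (intro real_sqrt_le_mono) auto
  then have R: "2 \<le> R" by simp
  obtain \<eta> where \<eta>: "0 < \<eta>" "\<eta> \<le> 1" "\<And>u. 0 \<le> u \<Longrightarrow> u \<le> 1 \<Longrightarrow>
      \<eta> * \<bar>barrier_feedback (real n) u\<bar> \<le> barrier_excess (real n) u"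
    using barrier_threshold_exists[of "real n"] assms by auto
  \<comment> \<open>This is \<open>D0\<close> as a function of the starting point. It tends to 0 at
    \<open>- R\<close>, so all smallness conditions hold near \<open>- R\<close> and one
    \<open>\<delta>\<close> serves both sides.\<close>
  define d0 where "d0 r = - real n / r + r / 2" for r
  have d0_lim: "(d0 \<longlongrightarrow> 0) (at (- R))"
    unfolding d0_def[abs_def] using R R2
    by (auto intro!: tendsto_eq_intros simp: field_simps power2_eq_square)
  have d0_less: "0 < d0 r" if "- R < r" "r < 0" for r
  proof -
    have "(- r)\<^sup>2 < R\<^sup>2" using that by (intro power_strict_mono) auto
    then show ?thesis using that R2 by (simp add: d0_def field_simps power2_eq_square)
  qed
  have d0_greater: "d0 r < 0" if "r < - R" for r
  proof -
    have "R\<^sup>2 < (- r)\<^sup>2" using that R by (intro power_strict_mono) auto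
    then show ?thesis using that R R2 by (simp add: d0_def field_simps power2_eq_square)
  qed
  have "((\<lambda>r. 3 * 2 ^ n * (d0 r * (- r))) \<longlongrightarrow> 3 * 2 ^ n * (0 * (- (- R)))) (at (- R))"
    by (intro tendsto_intros d0_lim)
  then have "\<forall>\<^sub>F r in at (- R). 3 * 2 ^ n * (d0 r * (- r)) < \<eta>"
    by (rule order_tendstoD(2)) (use \<eta> in simp)
  moreover have "((\<lambda>r. d0 r * r) \<longlongrightarrow> 0 * (- R)) (at (- R))"
    by (intro tendsto_intros d0_lim)
  then have "\<forall>\<^sub>F r in at (- R). d0 r * r < \<eta>"
    by (rule order_tendstoD(2)) (use \<eta> in simp)
  moreover have "((\<lambda>r. (\<eta> / (- r) ^ 3) ^ (n + 1) - - d0 r * (- r) ^ (n + 2) / \<eta>)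
      \<longlongrightarrow> (\<eta> / (- (- R)) ^ 3) ^ (n + 1) - - 0 * (- (- R)) ^ (n + 2) / \<eta>) (at (- R))"
    using R \<eta> by (intro tendsto_intros d0_lim) auto
  then have "\<forall>\<^sub>F r in at (- R). 0 < (\<eta> / (- r) ^ 3) ^ (n + 1) - - d0 r * (- r) ^ (n + 2) / \<eta>"
    by (rule order_tendstoD(1)) (use \<eta> R in simp)
  ultimately have "\<forall>\<^sub>F r in at (- R). 3 * 2 ^ n * (d0 r * (- r)) < \<eta> \<and> d0 r * r < \<eta> \<and>
      - d0 r * (- r) ^ (n + 2) / \<eta> < (\<eta> / (- r) ^ 3) ^ (n + 1)"
    by eventually_elim auto
  then obtain \<delta> where \<delta>: "0 < \<delta>"
    and small: "\<And>r. r \<noteq> - R \<Longrightarrow> dist r (- R) < \<delta> \<Longrightarrow> 3 * 2 ^ n * (d0 r * (- r)) < \<eta> \<and> d0 r * r < \<eta> \<and>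
      - d0 r * (- r) ^ (n + 2) / \<eta> < (\<eta> / (- r) ^ 3) ^ (n + 1)"
    unfolding eventually_at by auto
  have above: "angle (sphere_profile n) r < angle g r"
    if r0: "r0 < 0" "- R < r0" "r0 < - R + \<delta>" and sol: "shrinker_solution n r0 c g"
      and r: "r \<in> portion r0 c g" "r \<in> portion (- R) 0 (sphere_profile n)" for r0 c g r
  proof -
    interpret shrinker_arc n r0 c g r by unfold_locales (fact assms sol r)+
    have D: "0 < D y" if "r0 < y" "y \<le> r" for y
      using D_pos[OF \<eta>(1,3) _ _ that] d0_less[of r0] small[of r0] r0
      by (simp add: D0_def d0_def dist_real_def)
    have "- 1 / r0 \<le> \<psi> r"
      using psi_sign[OF r0_less_x order_refl, of 1] D by (simp add: less_imp_le)
    \<comment> \<open>Strictness comes from the initial values \<open>- 1 / r0\<close> and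
      \<open>1 / R\<close> of the two rotational curvatures; the latter is constant on the
      sphere.\<close>
    moreover have "1 / R < - 1 / r0" using r0 R by (simp add: field_simps)
    ultimately have "1 / R < - si r / r" by (simp add: \<psi>_def)
    then have "- r / R < si r" using x_neg R by (simp add: field_simps)
    then show ?thesis
      using angle_sphere_profile[of n r] r(2) x_neg r0_less_x r0
      by (simp add: angle_less_iff_sin si_def R_def)
  qed
  have below: "angle g r < angle (sphere_profile n) r"
    if r0: "r0 < 0" "- R - \<delta> < r0" "r0 < - R" and sol: "shrinker_solution n r0 c g"
      and r: "r \<in> portion r0 c g" "r \<in> portion (- R) 0 (sphere_profile n)" for r0 c g r
  proof -
    interpret shrinker_arc n r0 c g r by unfold_locales (fact assms sol r)+
    have D: "D y < 0" if "r0 < y" "y \<le> r" for y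
      using D_neg[OF \<eta> _ _ _ _ that] d0_greater[of r0] small[of r0] r0 R
      by (simp add: D0_def d0_def dist_real_def)
    have "\<psi> r \<le> - 1 / r0"
      using psi_sign[OF r0_less_x order_refl, of "-1"] D by (simp add: less_imp_le)
    moreover have "- 1 / r0 < 1 / R" using r0 R by (simp add: field_simps)
    ultimately have "- si r / r < 1 / R" by (simp add: \<psi>_def)
    then have "si r < - r / R" using x_neg R by (simp add: field_simps)
    moreover have "- R < r" using r(2) by (simp add: portion_def)
    ultimately show ?thesis
      using angle_sphere_profile[of n r] x_neg
      by (simp add: angle_less_iff_sin si_def R_def)
  qed
  show ?thesis
    using above below \<delta> unfolding R_def by (intro conjI exI[of _ \<delta>]) auto
qed

end
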